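(* Let $\Lambda\subset\mathbb{Z}^d$ be a finite lattice, $S=\{0,1\}^{\Lambda}$, and let $L$ be the generator of a continuous-time Markov chain on $S$ with transition rates satisfying, for $\sigma\ne\sigma'$: $q(\sigma,\sigma')=q(\sigma,\sigma^x)>0$ if $\sigma'=\sigma^x$ for some $x\in\Lambda$, and $q(\sigma,\sigma')=0$ otherwise. Let $\Delta t\in(0,1)$ and $P_{\Delta t}(\sigma,\sigma')=e^{\Delta t L}\delta_{\sigma'}(\sigma)$. Let $L=L_1+L_2$ be the splitting of $L$ induced by a decomposition of the lattice $\Lambda$, and let $Q^{\mathrm{Lie}}_{\Delta t}$ and $Q^{\mathrm{Strang}}_{\Delta t}$ be the associated Lie and Strang splitting approximations. (i) If there exist a state $\sigma\in S$ and distinct lattice sites $x,y\in\Lambda$ such that the Lie commutator satisfies $C_{\mathrm{Lie}}(\sigma,\sigma^{x,y})\neq 0$, then $$H(Q^{\mathrm{Lie}}_{\Delta t}\,|\,P_{\Delta t})=O(\Delta t)\qquad(\Delta t\to 0).$$ (ii) If there exist a state $\sigma\in S$ and distinct lattice sites $x,y,z\in\Lambda$ such that the Strang commutator satisfies $C_{\mathrm{Strang}}(\sigma,\sigma^{x,y,z})\neq 0$, then $$H(Q^{\mathrm{Strang}}_{\Delta t}\,|\,P_{\Delta t})=O(\Delta t^2)\qquad(\Delta t\to 0).$$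
   Context: For $\sigma\in S$ and distinct sites, $\sigma^x$, $\sigma^{x,y}$, $\sigma^{x,y,z}$ denote the configurations obtained from $\sigma$ by flipping the spin ($0\leftrightarrow1$) at $x$; at $x$ and $y$; at $x$, $y$ and $z$, respectively. $\delta_{\sigma'}(\sigma)=1$ if $\sigma=\sigma'$ and $0$ otherwise. The generator is $L[f](\sigma)=\sum_{x\in\Lambda}q(\sigma,\sigma^x)(f(\sigma^x)-f(\sigma))$ for $f:S\to\mathbb{R}$. Localization: each site $x$ has a neighborhood $\Omega_x\subset\Lambda$ such that $q(\sigma,\sigma^x)$ depends only on $\sigma(x)$ and on the values $\sigma(y)$, $y\in\Omega_x$. Decomposition: $\Lambda$ is partitioned into non-overlapping sub-lattices $\Lambda_i$, which are collected into two groups; $G_1$ and $G_2$ denote the unions of the sub-lattices in each group, so $\Lambda=G_1\cup G_2$ is a disjoint union. Transitions in different sub-lattices of the same group are independent of each other: if $\Lambda_i\ne\Lambda_j$ are in the same group and $x\in\Lambda_i$, then $\Omega_x\cap\Lambda_j=\emptyset$. The induced splitting is $L_j[f](\sigma)=\sum_{x\in G_j}q(\sigma,\sigma^x)(f(\sigma^x)-f(\sigma))$, $j=1,2$. Splitting approximations: $$Q^{\mathrm{Lie}}_{\Delta t}(\sigma,\sigma')=e^{\Delta t L_1}e^{\Delta t L_2}\delta_{\sigma'}(\sigma),\qquad Q^{\mathrm{Strang}}_{\Delta t}(\sigma,\sigma')=e^{\frac{\Delta t}{2}L_1}e^{\Delta t L_2}e^{\frac{\Delta t}{2}L_1}\delta_{\sigma'}(\sigma).$$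 Commutators, with $[X,Y]=XY-YX$: $$C_{\mathrm{Lie}}(\sigma,\sigma')=\tfrac12[L_1,L_2]\delta_{\sigma'}(\sigma),\qquad C_{\mathrm{Strang}}(\sigma,\sigma')=\tfrac1{24}\big([L_1,[L_1,L_2]]-2[L_2,[L_2,L_1]]\big)\delta_{\sigma'}(\sigma).$$ Relative entropy rate (normalized by $\Delta t$): for a transition matrix $Q_{\Delta t}$ with unique stationary distribution $\mu_Q$, $$H(Q_{\Delta t}|P_{\Delta t})=\frac1{\Delta t}\sum_{\sigma,\sigma'\in S}\mu_Q(\sigma)\,Q_{\Delta t}(\sigma,\sigma')\log\frac{Q_{\Delta t}(\sigma,\sigma')}{P_{\Delta t}(\sigma,\sigma')}.$$ *)

theory Defs
  imports
    "HOL-Analysis.Finite_Cartesian_Product"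
    "HOL-Probability.Probability_Mass_Function"
    "HOL-Library.Disjoint_Sets"
    "HOL-Library.FuncSet"
    "HOL-Library.Landau_Symbols"
begin

type_synonym 'a config = "'a \<Rightarrow> nat"

text \<open>A configuration on a set of sites is a \<open>{0,1}\<close>-valued function that is
  \<open>undefined\<close> off that set, so that the configurations form a finite set.\<close>

definition configs :: "'a set \<Rightarrow> 'a config set" where
  "configs \<Lambda> = \<Lambda> \<rightarrow>\<^sub>E {0, 1}"

definition flip :: "'a \<Rightarrow> 'a config \<Rightarrow> 'a config" where
  "flip x \<sigma> = \<sigma>(x := 1 - \<sigma> x)"

definition delta :: "'s \<Rightarrow> 's \<Rightarrow> real" where
  "delta \<sigma>' \<sigma> = (if \<sigma> = \<sigma>' then 1 else 0)"

definition single_flip_rates :: "'a set \<Rightarrow> ('a config \<Rightarrow> 'a config \<Rightarrow> real) \<Rightarrow> bool" where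
  "single_flip_rates \<Lambda> q \<longleftrightarrow>
     (\<forall>\<sigma>\<in>configs \<Lambda>. \<forall>\<sigma>'\<in>configs \<Lambda>. \<sigma> \<noteq> \<sigma>' \<longrightarrow>
        (if \<exists>x\<in>\<Lambda>. \<sigma>' = flip x \<sigma> then q \<sigma> \<sigma>' > 0 else q \<sigma> \<sigma>' = 0))"

definition localized_rates ::
    "'a set \<Rightarrow> ('a config \<Rightarrow> 'a config \<Rightarrow> real) \<Rightarrow> ('a \<Rightarrow> 'a set) \<Rightarrow> bool" where
  "localized_rates \<Lambda> q \<Omega> \<longleftrightarrow>
     (\<forall>x\<in>\<Lambda>. \<Omega> x \<subseteq> \<Lambda> \<and>
        (\<forall>\<sigma>\<in>configs \<Lambda>. \<forall>\<tau>\<in>configs \<Lambda>.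
           \<sigma> x = \<tau> x \<and> (\<forall>y\<in>\<Omega> x. \<sigma> y = \<tau> y) \<longrightarrow> q \<sigma> (flip x \<sigma>) = q \<tau> (flip x \<tau>)))"

text \<open>\<open>\<G>1\<close> and \<open>\<G>2\<close> are the two groups, each one a set of sub-lattices;
  the unions written $G_1$ and $G_2$ on paper are \<open>\<Union>\<G>1\<close> and \<open>\<Union>\<G>2\<close>.
  A group may be empty.\<close>

definition lattice_decomposition ::
    "'a set \<Rightarrow> ('a \<Rightarrow> 'a set) \<Rightarrow> 'a set set \<Rightarrow> 'a set set \<Rightarrow> bool" where
  "lattice_decomposition \<Lambda> \<Omega> \<G>1 \<G>2 \<longleftrightarrow>
     partition_on \<Lambda> (\<G>1 \<union> \<G>2) \<and> \<G>1 \<inter> \<G>2 = {} \<and>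
     (\<forall>\<G>\<in>{\<G>1, \<G>2}. \<forall>A\<in>\<G>. \<forall>B\<in>\<G>. A \<noteq> B \<longrightarrow> (\<forall>x\<in>A. \<Omega> x \<inter> B = {}))"

text \<open>Operators act on all real functions of a configuration.  At a configuration of
  \<open>configs \<Lambda>\<close> the operators below only see the values on \<open>configs \<Lambda>\<close>, because that
  set is closed under flips at sites of \<open>\<Lambda>\<close>.\<close>

type_synonym 's operator = "('s \<Rightarrow> real) \<Rightarrow> 's \<Rightarrow> real"

definition generator :: "('a config \<Rightarrow> 'a config \<Rightarrow> real) \<Rightarrow> 'a set \<Rightarrow> 'a config operator" where
  "generator q A f \<sigma> = (\<Sum>x\<in>A. q \<sigma> (flip x \<sigma>) * (f (flip x \<sigma>) - f \<sigma>))"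

text \<open>The exponential $e^{tX}$, as its power series evaluated pointwise.\<close>

definition op_exp :: "real \<Rightarrow> 's operator \<Rightarrow> 's operator" where
  "op_exp t X f \<sigma> = (\<Sum>n. t ^ n / fact n * (X ^^ n) f \<sigma>)"

definition commutator :: "'s operator \<Rightarrow> 's operator \<Rightarrow> 's operator" where
  "commutator X Y f \<sigma> = X (Y f) \<sigma> - Y (X f) \<sigma>"

definition exact_kernel :: "'s operator \<Rightarrow> real \<Rightarrow> 's \<Rightarrow> 's \<Rightarrow> real" where
  "exact_kernel L t \<sigma> \<sigma>' = op_exp t L (delta \<sigma>') \<sigma>"

definition lie_kernel :: "'s operator \<Rightarrow> 's operator \<Rightarrow> real \<Rightarrow> 's \<Rightarrow> 's \<Rightarrow> real" where
  "lie_kernel L1 L2 t \<sigma> \<sigma>' = op_exp t L1 (op_exp t L2 (delta \<sigma>')) \<sigma>"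

definition strang_kernel :: "'s operator \<Rightarrow> 's operator \<Rightarrow> real \<Rightarrow> 's \<Rightarrow> 's \<Rightarrow> real" where
  "strang_kernel L1 L2 t \<sigma> \<sigma>' =
     op_exp (t / 2) L1 (op_exp t L2 (op_exp (t / 2) L1 (delta \<sigma>'))) \<sigma>"

definition lie_commutator :: "'s operator \<Rightarrow> 's operator \<Rightarrow> 's \<Rightarrow> 's \<Rightarrow> real" where
  "lie_commutator L1 L2 \<sigma> \<sigma>' = 1 / 2 * commutator L1 L2 (delta \<sigma>') \<sigma>"

definition strang_commutator :: "'s operator \<Rightarrow> 's operator \<Rightarrow> 's \<Rightarrow> 's \<Rightarrow> real" where
  "strang_commutator L1 L2 \<sigma> \<sigma>' =
     1 / 24 * (commutator L1 (commutator L1 L2) (delta \<sigma>') \<sigma>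
             - 2 * commutator L2 (commutator L2 L1) (delta \<sigma>') \<sigma>)"

definition stationary :: "'s set \<Rightarrow> ('s \<Rightarrow> 's \<Rightarrow> real) \<Rightarrow> 's pmf \<Rightarrow> bool" where
  "stationary S Q \<mu> \<longleftrightarrow>
     set_pmf \<mu> \<subseteq> S \<and> (\<forall>\<sigma>'\<in>S. (\<Sum>\<sigma>\<in>S. pmf \<mu> \<sigma> * Q \<sigma> \<sigma>') = pmf \<mu> \<sigma>')"

text \<open>Meaningful only when the stationary distribution exists and is unique; nothing is
  known about the value of the description otherwise.\<close>

definition stationary_distribution :: "'s set \<Rightarrow> ('s \<Rightarrow> 's \<Rightarrow> real) \<Rightarrow> 's pmf" where
  "stationary_distribution S Q = (THE \<mu>. stationary S Q \<mu>)"

definition rel_entropy_rate ::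
    "'s set \<Rightarrow> real \<Rightarrow> ('s \<Rightarrow> 's \<Rightarrow> real) \<Rightarrow> ('s \<Rightarrow> 's \<Rightarrow> real) \<Rightarrow> real" where
  "rel_entropy_rate S t Q P =
     1 / t * (\<Sum>\<sigma>\<in>S. \<Sum>\<sigma>'\<in>S.
       pmf (stationary_distribution S Q) \<sigma> * Q \<sigma> \<sigma>' * ln (Q \<sigma> \<sigma>' / P \<sigma> \<sigma>'))"

end

(* The rows of Q and P both sum to 1, so the relative entropy of a row lies between 0 and the
   chi-square distance, the sum of (Q - P)^2 / P. If sigma' differs from sigma at d sites, then
   P(sigma, sigma') is bounded below by a multiple of t^d, because L + c I has nonnegative entries
   for large c and d flips connect the two configurations. The kernels are power series in t. Their
   coefficients of order below d vanish, as each application of a generator performs at most one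
   flip, and those of order at most m agree, with m = 1 for Lie and m = 2 for Strang. Hence
   |Q - P| <= C t^max(d, m + 1), each chi-square term is O(t^(m+1)), and the rate is O(t^m). *)

theory Submission
  imports Defs
begin

section \<open>Exponentials of operators on a finite set\<close>

text \<open>\<open>X\<close> acts on \<open>S\<close> as a finite matrix; nothing is required of \<open>X f\<close> outside \<open>S\<close>.\<close>

definition kernel_op :: "'s set \<Rightarrow> 's operator \<Rightarrow> bool" where
  "kernel_op S X \<longleftrightarrow> (\<forall>f. \<forall>\<sigma>\<in>S. X f \<sigma> = (\<Sum>\<tau>\<in>S. f \<tau> * X (delta \<tau>) \<sigma>))"

lemma kernel_opD: "kernel_op S X \<Longrightarrow> \<sigma> \<in> S \<Longrightarrow> X f \<sigma> = (\<Sum>\<tau>\<in>S. f \<tau> * X (delta \<tau>) \<sigma>)"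
  unfolding kernel_op_def by blast

lemma sum_mult_delta:
  assumes "finite S" "\<sigma> \<in> S"
  shows "(\<Sum>\<tau>\<in>S. f \<tau> * delta \<tau> \<sigma>) = f \<sigma>"
proof -
  have "f \<tau> * delta \<tau> \<sigma> = (if \<sigma> = \<tau> then f \<tau> else 0)" for \<tau>
    by (simp add: delta_def)
  then show ?thesis using assms by simp
qed

text \<open>Functions are total on the type, while identities are known only on \<open>S\<close>;
  this is how such an identity is carried through \<open>X\<close>.\<close>

lemma kernel_op_cong:
  assumes "kernel_op S X" "\<sigma> \<in> S" "\<And>\<tau>. \<tau> \<in> S \<Longrightarrow> f \<tau> = g \<tau>"
  shows "X f \<sigma> = X g \<sigma>"
  using assms(3) by (simp add: kernel_opD[OF assms(1,2), of f] kernel_opD[OF assms(1,2), of g])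

lemma kernel_op_sum:
  assumes "kernel_op S X" "\<sigma> \<in> S"
  shows "X (\<lambda>\<rho>. \<Sum>i\<in>I. a i * g i \<rho>) \<sigma> = (\<Sum>i\<in>I. a i * X (g i) \<sigma>)"
  by (simp add: kernel_opD[OF assms, of "\<lambda>\<rho>. \<Sum>i\<in>I. a i * g i \<rho>"]
      kernel_opD[OF assms, of "g _"] sum_distrib_left sum_distrib_right mult.assoc)
    (rule sum.swap)

lemma kernel_op_comp:
  assumes "kernel_op S X" "kernel_op S Y"
  shows "kernel_op S (\<lambda>f. X (Y f))"
  unfolding kernel_op_def
proof (intro allI ballI)
  fix f \<sigma> assume s: "\<sigma> \<in> S"
  have "X (Y f) \<sigma> = X (\<lambda>\<rho>. \<Sum>\<tau>\<in>S. f \<tau> * Y (delta \<tau>) \<rho>) \<sigma>"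
    by (rule kernel_op_cong[OF assms(1) s]) (rule kernel_opD[OF assms(2)])
  then show "X (Y f) \<sigma> = (\<Sum>\<tau>\<in>S. f \<tau> * X (Y (delta \<tau>)) \<sigma>)"
    by (simp add: kernel_op_sum[OF assms(1) s])
qed

lemma kernel_op_funpow:
  assumes "finite S" "kernel_op S X"
  shows "kernel_op S (X ^^ n)"
proof (induction n)
  case 0
  show ?case using sum_mult_delta[OF assms(1)] by (simp add: kernel_op_def)
next
  case (Suc n)
  show ?case using kernel_op_comp[OF assms(2) Suc] by (simp add: o_def)
qed

text \<open>Sup-norm boundedness of a finite matrix. \<open>B\<close> is obtained before
  \<open>n\<close>, \<open>f\<close> and \<open>M\<close>, as a comparison with an exponential
  series requires.\<close>

lemma funpow_bound:
  fixes S :: "'s set"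
  assumes fin: "finite S" and X: "kernel_op S X"
  obtains B where "0 \<le> B"
    "\<And>n (f :: _ \<Rightarrow> real) M \<sigma>. (\<And>\<tau>. \<tau> \<in> S \<Longrightarrow> \<bar>f \<tau>\<bar> \<le> M) \<Longrightarrow> \<sigma> \<in> S \<Longrightarrow> \<bar>(X ^^ n) f \<sigma>\<bar> \<le> B ^ n * M"
proof
  \<comment> \<open>The sum of all absolute entries dominates every absolute row sum, hence the
    operator norm for the sup norm on \<open>S\<close>.\<close>
  let ?B = "\<Sum>\<sigma>\<in>S. \<Sum>\<tau>\<in>S. \<bar>X (delta \<tau>) \<sigma>\<bar>"
  show "0 \<le> ?B" by (intro sum_nonneg) auto
  fix n M \<sigma> and f :: "'s \<Rightarrow> real" assume f: "\<And>\<tau>. \<tau> \<in> S \<Longrightarrow> \<bar>f \<tau>\<bar> \<le> M" and s: "\<sigma> \<in> S"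
  show "\<bar>(X ^^ n) f \<sigma>\<bar> \<le> ?B ^ n * M" using s
  proof (induction n arbitrary: \<sigma>)
    case 0
    then show ?case using f by simp
  next
    case (Suc n)
    let ?g = "(X ^^ n) f"
    \<comment> \<open>The sign of \<open>M\<close> is not assumed; it comes from the induction
      hypothesis, which bounds an absolute value.\<close>
    have M: "0 \<le> ?B ^ n * M" using Suc.IH[OF Suc.prems] by linarith
    have "\<bar>X ?g \<sigma>\<bar> \<le> (\<Sum>\<tau>\<in>S. \<bar>?g \<tau> * X (delta \<tau>) \<sigma>\<bar>)"
      unfolding kernel_opD[OF X Suc.prems, of ?g] by (rule sum_abs)
    also have "\<dots> \<le> (\<Sum>\<tau>\<in>S. (?B ^ n * M) * \<bar>X (delta \<tau>) \<sigma>\<bar>)"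
      unfolding abs_mult by (intro sum_mono mult_right_mono Suc.IH) auto
    also have "\<dots> = (?B ^ n * M) * (\<Sum>\<tau>\<in>S. \<bar>X (delta \<tau>) \<sigma>\<bar>)" by (simp add: sum_distrib_left)
    also have "\<dots> \<le> (?B ^ n * M) * ?B"
    proof (rule mult_left_mono[OF _ M])
      show "(\<Sum>\<tau>\<in>S. \<bar>X (delta \<tau>) \<sigma>\<bar>) \<le> ?B"
        using Suc.prems fin
        by (intro member_le_sum[where f = "\<lambda>\<sigma>. \<Sum>\<tau>\<in>S. \<bar>X (delta \<tau>) \<sigma>\<bar>"] sum_nonneg) auto
    qed
    finally show ?case by (simp add: ac_simps)
  qed
qed

text \<open>Domination by the exponential series of \<open>\<bar>t\<bar> * B\<close>. Convergence is
  absolute so that Cauchy products can be formed later.\<close>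

lemma abs_summable_op_exp:
  assumes fin: "finite S" and X: "kernel_op S X" and s: "\<sigma> \<in> S"
  shows "summable (\<lambda>n. norm (t ^ n / fact n * (X ^^ n) f \<sigma>))"
proof -
  obtain B where B: "0 \<le> B"
    "\<And>n (f :: _ \<Rightarrow> real) M \<sigma>. (\<And>\<tau>. \<tau> \<in> S \<Longrightarrow> \<bar>f \<tau>\<bar> \<le> M) \<Longrightarrow> \<sigma> \<in> S \<Longrightarrow> \<bar>(X ^^ n) f \<sigma>\<bar> \<le> B ^ n * M"
    using funpow_bound[OF fin X] by blast
  let ?M = "\<Sum>\<tau>\<in>S. \<bar>f \<tau>\<bar>"
  have f: "\<bar>f \<tau>\<bar> \<le> ?M" if "\<tau> \<in> S" for \<tau>
    using that fin by (intro member_le_sum[where f = "\<lambda>\<tau>. \<bar>f \<tau>\<bar>"]) auto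
  show ?thesis
  proof (rule summable_comparison_test')
    show "summable (\<lambda>n. inverse (fact n) * (\<bar>t\<bar> * B) ^ n * ?M)"
      by (intro summable_mult2 summable_exp)
    fix n
    have "norm (norm (t ^ n / fact n * (X ^^ n) f \<sigma>)) = \<bar>t\<bar> ^ n / fact n * \<bar>(X ^^ n) f \<sigma>\<bar>"
      by (simp add: abs_mult power_abs)
    also have "\<dots> \<le> \<bar>t\<bar> ^ n / fact n * (B ^ n * ?M)"
      by (intro mult_left_mono B(2) f s) auto
    also have "\<dots> = inverse (fact n) * (\<bar>t\<bar> * B) ^ n * ?M"
      by (simp add: field_simps power_mult_distrib)
    finally show "norm (norm (t ^ n / fact n * (X ^^ n) f \<sigma>))
      \<le> inverse (fact n) * (\<bar>t\<bar> * B) ^ n * ?M" .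
  qed
qed

text \<open>The expansion of \<open>f\<close> into deltas is a finite sum, so it may be exchanged
  with the exponential series.\<close>

lemma kernel_op_op_exp:
  assumes fin: "finite S" and X: "kernel_op S X"
  shows "kernel_op S (op_exp t X)"
  unfolding kernel_op_def
proof (intro allI ballI)
  fix f \<sigma> assume s: "\<sigma> \<in> S"
  have sm: "summable (\<lambda>n. t ^ n / fact n * (X ^^ n) g \<sigma>)" for g
    using abs_summable_op_exp[OF fin X s] by (rule summable_norm_cancel)
  have "op_exp t X f \<sigma> = (\<Sum>n. \<Sum>\<tau>\<in>S. f \<tau> * (t ^ n / fact n * (X ^^ n) (delta \<tau>) \<sigma>))"
    unfolding op_exp_def
    by (subst kernel_opD[OF kernel_op_funpow[OF fin X] s]) (simp add: sum_distrib_left ac_simps)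
  also have "\<dots> = (\<Sum>\<tau>\<in>S. \<Sum>n. f \<tau> * (t ^ n / fact n * (X ^^ n) (delta \<tau>) \<sigma>))"
    by (intro suminf_sum summable_mult sm)
  also have "\<dots> = (\<Sum>\<tau>\<in>S. f \<tau> * op_exp t X (delta \<tau>) \<sigma>)"
    unfolding op_exp_def by (simp only: suminf_mult[OF sm])
  finally show "op_exp t X f \<sigma> = (\<Sum>\<tau>\<in>S. f \<tau> * op_exp t X (delta \<tau>) \<sigma>)" .
qed

section \<open>Power series in the time step\<close>

text \<open>The series converges for every real \<open>t\<close>, with coefficients that are
  functions on configurations, so that a further operator exponential can be applied to them.
  Absolute convergence is built in for the sake of Cauchy products.\<close>

definition power_expansion :: "'s set \<Rightarrow> (real \<Rightarrow> 's \<Rightarrow> real) \<Rightarrow> (nat \<Rightarrow> 's \<Rightarrow> real) \<Rightarrow> bool" where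
  "power_expansion S F c \<longleftrightarrow> (\<forall>t. \<forall>\<sigma>\<in>S.
     summable (\<lambda>n. norm (t ^ n * c n \<sigma>)) \<and> F t \<sigma> = (\<Sum>n. t ^ n * c n \<sigma>))"

lemma power_expansionD:
  assumes "power_expansion S F c" "\<sigma> \<in> S"
  shows "summable (\<lambda>n. norm (t ^ n * c n \<sigma>))" "F t \<sigma> = (\<Sum>n. t ^ n * c n \<sigma>)"
  using assms unfolding power_expansion_def by blast+

text \<open>The factor \<open>a\<close> rescales time: \<open>a = 1 / 2\<close> gives the half steps
  of the Strang kernel.\<close>

lemma power_expansion_op_exp:
  assumes "finite S" "kernel_op S X"
  shows "power_expansion S (\<lambda>t. op_exp (a * t) X f) (\<lambda>n \<sigma>. a ^ n / fact n * (X ^^ n) f \<sigma>)"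
  unfolding power_expansion_def op_exp_def
  using abs_summable_op_exp[OF assms, of _ "a * _" f]
  by (simp add: power_mult_distrib mult.assoc mult.left_commute)

lemma summable_norm_Cauchy_product:
  fixes a b :: "nat \<Rightarrow> real"
  assumes "summable (\<lambda>n. norm (a n))" "summable (\<lambda>n. norm (b n))"
  shows "summable (\<lambda>n. norm (\<Sum>k\<le>n. a k * b (n - k)))"
proof (rule summable_comparison_test')
  show "summable (\<lambda>n. \<Sum>k\<le>n. norm (a k) * norm (b (n - k)))"
    by (rule summable_Cauchy_product) (use assms in auto)
  show "norm (norm (\<Sum>k\<le>n. a k * b (n - k))) \<le> (\<Sum>k\<le>n. norm (a k) * norm (b (n - k)))" for n
    using norm_sum[of "\<lambda>k. a k * b (n - k)" "{..n}"] by (simp add: abs_mult)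
qed

text \<open>On \<open>S\<close> the left side is a matrix applied to a vector, hence a finite sum of
  products of two absolutely convergent series. Each product is a Cauchy product, and summing over
  the intermediate configuration \<open>\<tau>\<close> reassembles the powers of
  \<open>X\<close>.\<close>

lemma power_expansion_op_exp_comp:
  assumes fin: "finite S" and X: "kernel_op S X" and F: "power_expansion S F c"
  shows "power_expansion S (\<lambda>t. op_exp (a * t) X (F t))
    (\<lambda>n \<sigma>. \<Sum>k\<le>n. a ^ k / fact k * (X ^^ k) (c (n - k)) \<sigma>)"
  unfolding power_expansion_def
proof (intro allI ballI conjI)
  fix t \<sigma> assume s: "\<sigma> \<in> S"
  \<comment> \<open>\<open>e \<tau>\<close> is the series of the matrix entry at
    \<open>\<sigma>\<close> and \<open>\<tau>\<close> of the exponential, \<open>g \<tau>\<close>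
    the series of \<open>F t\<close> at \<open>\<tau>\<close>.\<close>
  define e where "e \<tau> n = t ^ n * (a ^ n / fact n * (X ^^ n) (delta \<tau>) \<sigma>)" for \<tau> n
  define g where "g \<tau> n = t ^ n * c n \<tau>" for \<tau> n
  have E: "summable (\<lambda>n. norm (e \<tau> n))" "op_exp (a * t) X (delta \<tau>) \<sigma> = (\<Sum>n. e \<tau> n)" for \<tau>
    unfolding e_def using power_expansionD[OF power_expansion_op_exp[OF fin X] s] by auto
  have G: "summable (\<lambda>n. norm (g \<tau> n))" "F t \<tau> = (\<Sum>n. g \<tau> n)" if "\<tau> \<in> S" for \<tau>
    unfolding g_def using power_expansionD[OF F that] by auto
  have coeff: "t ^ n * (\<Sum>k\<le>n. a ^ k / fact k * (X ^^ k) (c (n - k)) \<sigma>)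
      = (\<Sum>\<tau>\<in>S. \<Sum>k\<le>n. e \<tau> k * g \<tau> (n - k))" for n
  proof -
    have "t ^ n * (\<Sum>k\<le>n. a ^ k / fact k * (X ^^ k) (c (n - k)) \<sigma>)
      = (\<Sum>k\<le>n. \<Sum>\<tau>\<in>S. e \<tau> k * g \<tau> (n - k))"
      unfolding sum_distrib_left
    proof (rule sum.cong[OF refl])
      fix k assume "k \<in> {..n}"
      then have "t ^ n = t ^ k * t ^ (n - k)" by (simp flip: power_add)
      then show "t ^ n * (a ^ k / fact k * (X ^^ k) (c (n - k)) \<sigma>)
          = (\<Sum>\<tau>\<in>S. e \<tau> k * g \<tau> (n - k))"
        by (subst kernel_opD[OF kernel_op_funpow[OF fin X] s])
          (simp add: e_def g_def sum_distrib_left ac_simps)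
    qed
    also have "\<dots> = (\<Sum>\<tau>\<in>S. \<Sum>k\<le>n. e \<tau> k * g \<tau> (n - k))" by (rule sum.swap)
    finally show ?thesis .
  qed
  have sm: "summable (\<lambda>n. norm (\<Sum>k\<le>n. e \<tau> k * g \<tau> (n - k)))" if "\<tau> \<in> S" for \<tau>
    using E(1) G(1)[OF that] by (rule summable_norm_Cauchy_product)
  show "summable (\<lambda>n. norm (t ^ n * (\<Sum>k\<le>n. a ^ k / fact k * (X ^^ k) (c (n - k)) \<sigma>)))"
    unfolding coeff
  proof (rule summable_comparison_test')
    show "summable (\<lambda>n. \<Sum>\<tau>\<in>S. norm (\<Sum>k\<le>n. e \<tau> k * g \<tau> (n - k)))"
      by (intro summable_sum sm)
    show "norm (norm (\<Sum>\<tau>\<in>S. \<Sum>k\<le>n. e \<tau> k * g \<tau> (n - k)))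
        \<le> (\<Sum>\<tau>\<in>S. norm (\<Sum>k\<le>n. e \<tau> k * g \<tau> (n - k)))" for n
      using norm_sum by auto
  qed
  have "op_exp (a * t) X (F t) \<sigma> = (\<Sum>\<tau>\<in>S. F t \<tau> * op_exp (a * t) X (delta \<tau>) \<sigma>)"
    by (rule kernel_opD[OF kernel_op_op_exp[OF fin X] s])
  also have "\<dots> = (\<Sum>\<tau>\<in>S. \<Sum>n. \<Sum>k\<le>n. e \<tau> k * g \<tau> (n - k))"
    using Cauchy_product[OF E(1) G(1)] by (intro sum.cong refl) (simp add: E(2) G(2) mult.commute)
  also have "\<dots> = (\<Sum>n. \<Sum>\<tau>\<in>S. \<Sum>k\<le>n. e \<tau> k * g \<tau> (n - k))"
    by (rule suminf_sum[symmetric]) (rule summable_norm_cancel[OF sm])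
  finally show "op_exp (a * t) X (F t) \<sigma>
      = (\<Sum>n. t ^ n * (\<Sum>k\<le>n. a ^ k / fact k * (X ^^ k) (c (n - k)) \<sigma>))"
    unfolding coeff .
qed

text \<open>Only terms of order at least \<open>m\<close> survive in the difference, and for these
  \<open>t ^ n \<le> t ^ m\<close> on the unit interval.\<close>

lemma power_expansion_diff_bound:
  assumes F: "power_expansion S F c" and G: "power_expansion S G d" and s: "\<sigma> \<in> S"
    and eq: "\<And>n. n < m \<Longrightarrow> c n \<sigma> = d n \<sigma>"
  obtains C where "\<And>t. 0 \<le> t \<Longrightarrow> t \<le> 1 \<Longrightarrow> \<bar>F t \<sigma> - G t \<sigma>\<bar> \<le> C * t ^ m"
proof
  let ?r = "\<lambda>n. c n \<sigma> - d n \<sigma>"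
  note c = power_expansionD[OF F s] and d = power_expansionD[OF G s]
  \<comment> \<open>At \<open>t = 1\<close> the expansions give absolute summability of the
    coefficients themselves; the sum of \<open>\<bar>?r n\<bar>\<close> is the constant
    \<open>C\<close>.\<close>
  have r: "summable (\<lambda>n. \<bar>?r n\<bar>)"
    by (rule summable_comparison_test'[OF summable_add[OF c(1)[of 1] d(1)[of 1]]]) simp
  fix t :: real assume t: "0 \<le> t" "t \<le> 1"
  have le: "\<bar>t ^ n * ?r n\<bar> \<le> t ^ m * \<bar>?r n\<bar>" for n
  proof (cases "n < m")
    case False
    then have "t ^ n \<le> t ^ m" using t by (intro power_decreasing) auto
    then show ?thesis using t by (simp add: abs_mult mult_right_mono)
  qed (simp add: eq)
  have sm: "summable (\<lambda>n. \<bar>t ^ n * ?r n\<bar>)"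
    by (rule summable_comparison_test'[OF summable_mult[OF r]]) (use le in simp)
  have "F t \<sigma> - G t \<sigma> = (\<Sum>n. t ^ n * ?r n)"
    unfolding c(2) d(2) right_diff_distrib
    by (rule suminf_diff) (rule summable_norm_cancel, rule c d)+
  then have "\<bar>F t \<sigma> - G t \<sigma>\<bar> \<le> (\<Sum>n. \<bar>t ^ n * ?r n\<bar>)"
    using summable_rabs[OF sm] by simp
  also have "\<dots> \<le> (\<Sum>n. t ^ m * \<bar>?r n\<bar>)" by (intro suminf_le le sm summable_mult r)
  also have "\<dots> = (\<Sum>n. \<bar>?r n\<bar>) * t ^ m" by (simp add: suminf_mult[OF r] mult.commute)
  finally show "\<bar>F t \<sigma> - G t \<sigma>\<bar> \<le> (\<Sum>n. \<bar>?r n\<bar>) * t ^ m" .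
qed

section \<open>Positivity and stochastic kernels\<close>

text \<open>Uniformization: adding a multiple of the identity lifts the negative diagonal of a
  generator and changes its exponential only by a scalar factor.\<close>

definition shifted :: "real \<Rightarrow> 's operator \<Rightarrow> 's operator" where
  "shifted c X f \<sigma> = X f \<sigma> + c * f \<sigma>"

definition positive_op :: "'s set \<Rightarrow> 's operator \<Rightarrow> bool" where
  "positive_op S X \<longleftrightarrow> (\<forall>f. (\<forall>\<tau>\<in>S. 0 \<le> f \<tau>) \<longrightarrow> (\<forall>\<sigma>\<in>S. 0 \<le> X f \<sigma>))"

lemma kernel_op_shifted:
  assumes "finite S" "kernel_op S X"
  shows "kernel_op S (shifted c X)"
  unfolding kernel_op_def shifted_def
proof (intro allI ballI)
  fix f \<sigma> assume s: "\<sigma> \<in> S"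
  have "(\<Sum>\<tau>\<in>S. f \<tau> * (X (delta \<tau>) \<sigma> + c * delta \<tau> \<sigma>))
      = (\<Sum>\<tau>\<in>S. f \<tau> * X (delta \<tau>) \<sigma>) + c * (\<Sum>\<tau>\<in>S. f \<tau> * delta \<tau> \<sigma>)"
    by (simp add: algebra_simps sum.distrib sum_distrib_left)
  then show "X f \<sigma> + c * f \<sigma> = (\<Sum>\<tau>\<in>S. f \<tau> * (X (delta \<tau>) \<sigma> + c * delta \<tau> \<sigma>))"
    by (simp add: kernel_opD[OF assms(2) s, of f] sum_mult_delta[OF assms(1) s])
qed

text \<open>The binomial theorem, valid because the identity commutes with \<open>X\<close>; the
  induction step is Pascal's rule.\<close>

lemma funpow_shifted:
  assumes X: "kernel_op S X" and s: "\<sigma> \<in> S"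
  shows "(shifted c X ^^ n) f \<sigma> = (\<Sum>k\<le>n. of_nat (n choose k) * c ^ (n - k) * (X ^^ k) f \<sigma>)"
  using s
proof (induction n arbitrary: \<sigma>)
  case 0
  then show ?case by simp
next
  case (Suc n)
  let ?x = "\<lambda>k. (X ^^ k) f \<sigma>"
  have "X ((shifted c X ^^ n) f) \<sigma>
      = X (\<lambda>\<rho>. \<Sum>k\<le>n. of_nat (n choose k) * c ^ (n - k) * (X ^^ k) f \<rho>) \<sigma>"
    by (rule kernel_op_cong[OF X Suc.prems]) (rule Suc.IH)
  also have "\<dots> = (\<Sum>k\<le>n. of_nat (n choose k) * c ^ (n - k) * ?x (Suc k))"
    by (simp add: kernel_op_sum[OF X Suc.prems])
  finally have 1: "X ((shifted c X ^^ n) f) \<sigma> = \<dots>" .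
  have "c * (shifted c X ^^ n) f \<sigma> = (\<Sum>k\<le>n. of_nat (n choose k) * c ^ (Suc n - k) * ?x k)"
    by (simp add: Suc.IH[OF Suc.prems] sum_distrib_left Suc_diff_le ac_simps)
  \<comment> \<open>The added term is zero since \<open>n choose Suc n = 0\<close>; with it the term
    \<open>k = 0\<close> can be split off and the index shifted.\<close>
  also have "\<dots> = (\<Sum>k\<le>Suc n. of_nat (n choose k) * c ^ (Suc n - k) * ?x k)" by simp
  also have "\<dots> = c ^ Suc n * ?x 0
      + (\<Sum>k\<le>n. of_nat (n choose Suc k) * c ^ (n - k) * ?x (Suc k))"
    by (simp only: sum.atMost_Suc_shift) simp
  finally have 2: "c * (shifted c X ^^ n) f \<sigma> = \<dots>" .
  have "(\<Sum>k\<le>Suc n. of_nat (Suc n choose k) * c ^ (Suc n - k) * ?x k) = c ^ Suc n * ?x 0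
      + (\<Sum>k\<le>n. of_nat (Suc n choose Suc k) * c ^ (n - k) * ?x (Suc k))"
    by (simp only: sum.atMost_Suc_shift) simp
  also have "\<dots> = X ((shifted c X ^^ n) f) \<sigma> + c * (shifted c X ^^ n) f \<sigma>"
    unfolding 1 2 by (simp add: sum.distrib algebra_simps)
  finally show ?case by (simp only: funpow.simps o_apply shifted_def[of c X "(shifted c X ^^ n) f"])
qed

text \<open>The Cauchy product with the series of \<open>exp (c * t)\<close> produces exactly the
  binomial sums of the shifted powers.\<close>

lemma op_exp_shifted:
  assumes fin: "finite S" and X: "kernel_op S X" and s: "\<sigma> \<in> S"
  shows "op_exp t (shifted c X) f \<sigma> = exp (c * t) * op_exp t X f \<sigma>"
proof -
  let ?a = "\<lambda>n. t ^ n / fact n * (X ^^ n) f \<sigma>"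
  let ?b = "\<lambda>n. (c * t) ^ n /\<^sub>R fact n"
  have "op_exp t X f \<sigma> * exp (c * t) = (\<Sum>n. \<Sum>k\<le>n. ?a k * ?b (n - k))"
    unfolding op_exp_def exp_def
    by (rule Cauchy_product[OF abs_summable_op_exp[OF fin X s] summable_norm_exp])
  also have "\<dots> = op_exp t (shifted c X) f \<sigma>"
    unfolding op_exp_def
  proof (rule suminf_cong)
    fix n
    have "?a k * ?b (n - k) = t ^ n / fact n * (of_nat (n choose k) * c ^ (n - k) * (X ^^ k) f \<sigma>)"
      if "k \<le> n" for k
    proof -
      have "t ^ n = t ^ k * t ^ (n - k)" using that by (simp flip: power_add)
      then show ?thesis
        using that by (simp add: binomial_fact power_mult_distrib divide_simps)
    qed
    then show "(\<Sum>k\<le>n. ?a k * ?b (n - k)) = t ^ n / fact n * (shifted c X ^^ n) f \<sigma>"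
      by (simp add: funpow_shifted[OF X s] sum_distrib_left)
  qed
  finally show ?thesis by (simp add: mult.commute)
qed

lemma positive_op_funpow:
  fixes f :: "'s \<Rightarrow> real"
  assumes "positive_op S X" "\<And>\<tau>. \<tau> \<in> S \<Longrightarrow> 0 \<le> f \<tau>" "\<sigma> \<in> S"
  shows "0 \<le> (X ^^ n) f \<sigma>"
  using assms(3)
proof (induction n arbitrary: \<sigma>)
  case 0
  then show ?case using assms(2) by simp
next
  case (Suc n)
  then show ?case using assms(1) unfolding positive_op_def by simp
qed

text \<open>After the shift every term of the series is nonnegative, so a single term bounds the sum
  from below. The choice \<open>n = 0\<close> yields nonnegativity, and \<open>n\<close> equal to
  the number of flips yields the leading order in \<open>t\<close>.\<close>

lemma op_exp_lower_bound:
  assumes fin: "finite S" and X: "kernel_op S X" and pos: "positive_op S (shifted c X)"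
    and f: "\<And>\<tau>. \<tau> \<in> S \<Longrightarrow> 0 \<le> f \<tau>" and s: "\<sigma> \<in> S" and t: "0 \<le> t"
  shows "exp (- c * t) * (t ^ n / fact n * (shifted c X ^^ n) f \<sigma>) \<le> op_exp t X f \<sigma>"
proof -
  let ?a = "\<lambda>n. t ^ n / fact n * (shifted c X ^^ n) f \<sigma>"
  have "?a n \<le> op_exp t (shifted c X) f \<sigma>"
    unfolding op_exp_def
    using sum_le_suminf[OF summable_norm_cancel[OF
          abs_summable_op_exp[OF fin kernel_op_shifted[OF fin X] s]], of "{n}" t c f]
      positive_op_funpow[OF pos f s] t by simp
  then have "exp (- c * t) * ?a n \<le> exp (- c * t) * (exp (c * t) * op_exp t X f \<sigma>)"
    unfolding op_exp_shifted[OF fin X s] by (rule mult_left_mono) simp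
  also have "\<dots> = op_exp t X f \<sigma>" by (simp flip: mult.assoc exp_add)
  finally show ?thesis .
qed

text \<open>The two equations hold between functions on the whole type, so they can be iterated
  without tracking membership in \<open>S\<close>; \<open>kernel_op\<close> by itself speaks only of
  values on \<open>S\<close>.\<close>

definition markov_generator :: "'s set \<Rightarrow> 's operator \<Rightarrow> bool" where
  "markov_generator S X \<longleftrightarrow> kernel_op S X \<and> X (\<lambda>_. 1) = (\<lambda>_. 0) \<and> X (\<lambda>_. 0) = (\<lambda>_. 0) \<and>
     (\<exists>c. positive_op S (shifted c X))"

definition stochastic :: "'s set \<Rightarrow> ('s \<Rightarrow> 's \<Rightarrow> real) \<Rightarrow> bool" where
  "stochastic S k \<longleftrightarrow> (\<forall>\<sigma>\<in>S. (\<forall>\<sigma>'\<in>S. 0 \<le> k \<sigma> \<sigma>') \<and> (\<Sum>\<sigma>'\<in>S. k \<sigma> \<sigma>') = 1)"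

lemma op_exp_one:
  assumes "markov_generator S X"
  shows "op_exp t X (\<lambda>_. 1) \<sigma> = 1"
proof -
  have "(X ^^ n) (\<lambda>_. 0) = (\<lambda>_. 0)" for n
    using assms by (induction n) (auto simp: markov_generator_def)
  then have "(X ^^ n) (\<lambda>_. 1) = (\<lambda>_. 0)" if "n \<noteq> 0" for n
    using assms that by (cases n) (simp_all add: markov_generator_def funpow_swap1)
  then have "op_exp t X (\<lambda>_. 1) \<sigma> = (\<Sum>n\<in>{0}. t ^ n / fact n * (X ^^ n) (\<lambda>_. 1) \<sigma>)"
    unfolding op_exp_def by (intro suminf_finite) auto
  then show ?thesis by simp
qed

lemma stochastic_delta: "finite S \<Longrightarrow> stochastic S (\<lambda>\<sigma> \<sigma>'. delta \<sigma>' \<sigma>)"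
  using sum_mult_delta[of S _ "\<lambda>_. 1"] by (auto simp: stochastic_def delta_def)

text \<open>The exponential acts on the columns of \<open>k\<close>, so this is a product of two
  stochastic matrices. Row sums stay 1 because the exponential fixes constants. Starting from the
  identity matrix and iterating covers all three kernels.\<close>

lemma stochastic_op_exp:
  assumes fin: "finite S" and X: "markov_generator S X" and k: "stochastic S k" and t: "0 \<le> t"
  shows "stochastic S (\<lambda>\<sigma> \<sigma>'. op_exp t X (\<lambda>\<rho>. k \<rho> \<sigma>') \<sigma>)"
  unfolding stochastic_def
proof (intro ballI conjI)
  fix \<sigma> assume s: "\<sigma> \<in> S"
  from X obtain c where ker: "kernel_op S X" and pos: "positive_op S (shifted c X)"
    unfolding markov_generator_def by blast
  note E = kernel_opD[OF kernel_op_op_exp[OF fin ker] s]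
  show "0 \<le> op_exp t X (\<lambda>\<rho>. k \<rho> \<sigma>') \<sigma>" if s': "\<sigma>' \<in> S" for \<sigma>'
  proof -
    have nn: "0 \<le> k \<tau> \<sigma>'" if "\<tau> \<in> S" for \<tau>
      using k s' that by (auto simp: stochastic_def)
    show ?thesis
      using op_exp_lower_bound[OF fin ker pos nn s t, where n = 0] nn[OF s]
      by simp (meson exp_ge_zero mult_nonneg_nonneg order_trans)
  qed
  have "(\<Sum>\<sigma>'\<in>S. op_exp t X (\<lambda>\<rho>. k \<rho> \<sigma>') \<sigma>)
      = (\<Sum>\<sigma>'\<in>S. \<Sum>\<tau>\<in>S. k \<tau> \<sigma>' * op_exp t X (delta \<tau>) \<sigma>)"
    by (subst E) simp
  also have "\<dots> = (\<Sum>\<tau>\<in>S. (\<Sum>\<sigma>'\<in>S. k \<tau> \<sigma>') * op_exp t X (delta \<tau>) \<sigma>)"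
    by (subst sum.swap) (simp add: sum_distrib_right)
  also have "\<dots> = (\<Sum>\<tau>\<in>S. 1 * op_exp t X (delta \<tau>) \<sigma>)"
    using k by (simp add: stochastic_def)
  also have "\<dots> = 1" using E[of t "\<lambda>_. 1"] op_exp_one[OF X] by simp
  finally show "(\<Sum>\<sigma>'\<in>S. op_exp t X (\<lambda>\<rho>. k \<rho> \<sigma>') \<sigma>) = 1" .
qed

section \<open>Relative entropy and the chi-square distance\<close>

text \<open>Both bounds are \<open>ln x \<le> x - 1\<close>, for \<open>x = b / a\<close> and for
  \<open>x = a / b\<close>. The linear part \<open>a - b\<close> is kept separate because it cancels
  when a row is summed.\<close>

lemma mult_ln_bounds:
  fixes a b :: real
  assumes "0 \<le> a" "0 < b"
  shows "a - b \<le> a * ln (a / b)" "a * ln (a / b) \<le> (a - b)\<^sup>2 / b + (a - b)"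
proof -
  have "a - b \<le> a * ln (a / b) \<and> a * ln (a / b) \<le> (a - b)\<^sup>2 / b + (a - b)"
  proof (cases "a = 0")
    \<comment> \<open>The factor \<open>a\<close> realizes the convention that
      \<open>0 * ln 0\<close> is 0; the upper bound is then an equality.\<close>
    case True
    then show ?thesis using assms by (simp add: power2_eq_square)
  next
    case False
    then have a: "0 < a" using assms by simp
    have "a * ln (b / a) \<le> a * (b / a - 1)"
      using a assms by (intro mult_left_mono ln_le_minus_one) auto
    moreover have "ln (b / a) = - ln (a / b)" using a assms by (simp add: ln_div)
    moreover have "a * (b / a - 1) = b - a" using a by (simp add: field_simps)
    moreover have "a * ln (a / b) \<le> a * (a / b - 1)"
      using a assms by (intro mult_left_mono ln_le_minus_one) auto
    moreover have "a * (a / b - 1) = (a - b)\<^sup>2 / b + (a - b)"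
      using assms by (simp add: field_simps power2_eq_square)
    ultimately show ?thesis by simp
  qed
  then show "a - b \<le> a * ln (a / b)" "a * ln (a / b) \<le> (a - b)\<^sup>2 / b + (a - b)" by auto
qed

text \<open>Summed over a row, the linear parts of the logarithm bounds cancel. Nonnegativity of
  each row's relative entropy removes the absolute value and lets the weights be replaced by
  1.\<close>

lemma rel_entropy_rate_bound:
  assumes fin: "finite S" and Q: "stochastic S Q" and P: "stochastic S P"
    and pos: "\<And>\<sigma> \<sigma>'. \<sigma> \<in> S \<Longrightarrow> \<sigma>' \<in> S \<Longrightarrow> 0 < P \<sigma> \<sigma>'" and t: "0 < t"
  shows "\<bar>rel_entropy_rate S t Q P\<bar>
    \<le> 1 / t * (\<Sum>\<sigma>\<in>S. \<Sum>\<sigma>'\<in>S. (Q \<sigma> \<sigma>' - P \<sigma> \<sigma>')\<^sup>2 / P \<sigma> \<sigma>')"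
proof -
  \<comment> \<open>The weights lie in the unit interval even if the stationary distribution is not unique.\<close>
  define \<mu> where "\<mu> = pmf (stationary_distribution S Q)"
  define KL where "KL \<sigma> = (\<Sum>\<sigma>'\<in>S. Q \<sigma> \<sigma>' * ln (Q \<sigma> \<sigma>' / P \<sigma> \<sigma>'))" for \<sigma>
  have mu: "0 \<le> \<mu> \<sigma>" "\<mu> \<sigma> \<le> 1" for \<sigma> by (auto simp: \<mu>_def pmf_le_1)
  have bounds: "0 \<le> KL \<sigma>" "KL \<sigma> \<le> (\<Sum>\<sigma>'\<in>S. (Q \<sigma> \<sigma>' - P \<sigma> \<sigma>')\<^sup>2 / P \<sigma> \<sigma>')" if s: "\<sigma> \<in> S" for \<sigma>
  proof -
    have nn: "0 \<le> Q \<sigma> \<sigma>'" if "\<sigma>' \<in> S" for \<sigma>' using Q s that by (auto simp: stochastic_def)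
    have eq: "(\<Sum>\<sigma>'\<in>S. Q \<sigma> \<sigma>' - P \<sigma> \<sigma>') = 0"
      using P Q s by (simp add: sum_subtractf stochastic_def)
    have "(\<Sum>\<sigma>'\<in>S. Q \<sigma> \<sigma>' - P \<sigma> \<sigma>') \<le> KL \<sigma>"
      unfolding KL_def by (intro sum_mono mult_ln_bounds nn pos s)
    then show "0 \<le> KL \<sigma>" using eq by simp
    have "KL \<sigma> \<le> (\<Sum>\<sigma>'\<in>S. (Q \<sigma> \<sigma>' - P \<sigma> \<sigma>')\<^sup>2 / P \<sigma> \<sigma>' + (Q \<sigma> \<sigma>' - P \<sigma> \<sigma>'))"
      unfolding KL_def by (intro sum_mono mult_ln_bounds nn pos s)
    then show "KL \<sigma> \<le> (\<Sum>\<sigma>'\<in>S. (Q \<sigma> \<sigma>' - P \<sigma> \<sigma>')\<^sup>2 / P \<sigma> \<sigma>')"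
      by (simp add: sum.distrib eq)
  qed
  have eq: "rel_entropy_rate S t Q P = 1 / t * (\<Sum>\<sigma>\<in>S. \<mu> \<sigma> * KL \<sigma>)"
    by (simp add: rel_entropy_rate_def \<mu>_def KL_def sum_distrib_left mult.assoc)
  have "\<bar>rel_entropy_rate S t Q P\<bar> = 1 / t * (\<Sum>\<sigma>\<in>S. \<mu> \<sigma> * KL \<sigma>)"
    unfolding eq using t mu bounds(1) by (intro abs_of_nonneg mult_nonneg_nonneg sum_nonneg) auto
  also have "\<dots> \<le> 1 / t * (\<Sum>\<sigma>\<in>S. \<Sum>\<sigma>'\<in>S. (Q \<sigma> \<sigma>' - P \<sigma> \<sigma>')\<^sup>2 / P \<sigma> \<sigma>')"
  proof (intro mult_left_mono sum_mono)
    fix \<sigma> assume s: "\<sigma> \<in> S"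
    have "\<mu> \<sigma> * KL \<sigma> \<le> 1 * KL \<sigma>" using mu bounds(1)[OF s] by (intro mult_right_mono)
    then show "\<mu> \<sigma> * KL \<sigma> \<le> (\<Sum>\<sigma>'\<in>S. (Q \<sigma> \<sigma>' - P \<sigma> \<sigma>')\<^sup>2 / P \<sigma> \<sigma>')"
      using bounds(2)[OF s] by simp
  qed (use t in simp)
  finally show ?thesis .
qed

text \<open>An entry of exact order \<open>t ^ d\<close> contributes at most \<open>t ^ (2 * max d (Suc m) - d)\<close> to the
  chi-square distance, which is at most \<open>t ^ Suc m\<close> whatever \<open>d\<close> is.\<close>

lemma rel_entropy_rate_bigo:
  fixes P Q :: "real \<Rightarrow> 's \<Rightarrow> 's \<Rightarrow> real" and d :: "'s \<Rightarrow> 's \<Rightarrow> nat"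
  assumes fin: "finite S"
    and st: "\<And>t. 0 < t \<Longrightarrow> t \<le> 1 \<Longrightarrow> stochastic S (Q t) \<and> stochastic S (P t)"
    and low: "\<And>\<sigma> \<sigma>'. \<sigma> \<in> S \<Longrightarrow> \<sigma>' \<in> S \<Longrightarrow>
      \<exists>c>0. \<forall>t. 0 < t \<longrightarrow> t \<le> 1 \<longrightarrow> c * t ^ d \<sigma> \<sigma>' \<le> P t \<sigma> \<sigma>'"
    and err: "\<And>\<sigma> \<sigma>'. \<sigma> \<in> S \<Longrightarrow> \<sigma>' \<in> S \<Longrightarrow>
      \<exists>C. \<forall>t. 0 < t \<longrightarrow> t \<le> 1 \<longrightarrow> \<bar>Q t \<sigma> \<sigma>' - P t \<sigma> \<sigma>'\<bar> \<le> C * t ^ max (d \<sigma> \<sigma>') (Suc m)"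
  shows "(\<lambda>t. rel_entropy_rate S t (Q t) (P t)) \<in> O[at_right 0](\<lambda>t. t ^ m)"
proof -
  let ?chi = "\<lambda>t \<sigma> \<sigma>'. (Q t \<sigma> \<sigma>' - P t \<sigma> \<sigma>')\<^sup>2 / P t \<sigma> \<sigma>'"
  have ev: "eventually (\<lambda>t::real. 0 < t \<and> t \<le> 1) (at_right 0)"
    unfolding eventually_at_right_field by (intro exI[of _ 1]) auto
  have pos: "0 < P t \<sigma> \<sigma>'" if "\<sigma> \<in> S" "\<sigma>' \<in> S" "0 < t" "t \<le> 1" for t \<sigma> \<sigma>'
    using low[OF that(1,2)] that(3,4) by (meson less_le_trans mult_pos_pos zero_less_power)
  have chi: "(\<lambda>t. ?chi t \<sigma> \<sigma>') \<in> O[at_right 0](\<lambda>t. t ^ Suc m)"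
    if s: "\<sigma> \<in> S" "\<sigma>' \<in> S" for \<sigma> \<sigma>'
  proof -
    define k where "k = d \<sigma> \<sigma>'"
    obtain c where c: "0 < c" "\<And>t. 0 < t \<Longrightarrow> t \<le> 1 \<Longrightarrow> c * t ^ k \<le> P t \<sigma> \<sigma>'"
      using low[OF s] unfolding k_def by blast
    obtain C where C: "\<And>t. 0 < t \<Longrightarrow> t \<le> 1 \<Longrightarrow> \<bar>Q t \<sigma> \<sigma>' - P t \<sigma> \<sigma>'\<bar> \<le> C * t ^ max k (Suc m)"
      using err[OF s] unfolding k_def by blast
    have "?chi t \<sigma> \<sigma>' \<le> C\<^sup>2 / c * t ^ Suc m" if t: "0 < t" "t \<le> 1" for t
    proof -
      have "(Q t \<sigma> \<sigma>' - P t \<sigma> \<sigma>')\<^sup>2 \<le> (C * t ^ max k (Suc m))\<^sup>2"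
        using C[OF t] by (metis abs_ge_zero power2_abs power_mono)
      also have "\<dots> = C\<^sup>2 * t ^ (max k (Suc m) + max k (Suc m))"
        by (simp add: power2_eq_square power_add ac_simps)
      \<comment> \<open>Twice the maximum is at least the sum of the two exponents, and
        \<open>t \<le> 1\<close>. Division by the lower bound \<open>c * t ^ k\<close> then leaves
        \<open>t ^ Suc m\<close>.\<close>
      also have "\<dots> \<le> C\<^sup>2 * t ^ (k + Suc m)"
        using t by (intro mult_left_mono power_decreasing) auto
      finally have "?chi t \<sigma> \<sigma>' \<le> C\<^sup>2 * t ^ (k + Suc m) / (c * t ^ k)"
        using t c by (intro frac_le) auto
      also have "\<dots> = C\<^sup>2 / c * t ^ Suc m" using t c by (simp add: power_add field_simps)
      finally show ?thesis .
    qed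
    moreover have "norm (?chi t \<sigma> \<sigma>') = ?chi t \<sigma> \<sigma>'" if "0 < t" "t \<le> 1" for t
      using pos[OF s that] by simp
    ultimately show ?thesis
      by (intro bigoI[of _ "C\<^sup>2 / c"] eventually_mono[OF ev])
        (simp only: real_norm_def power_abs abs_of_pos)
  qed
  have "(\<lambda>t. \<Sum>\<sigma>\<in>S. \<Sum>\<sigma>'\<in>S. ?chi t \<sigma> \<sigma>') \<in> O[at_right 0](\<lambda>t. t ^ Suc m)"
    by (intro big_sum_in_bigo chi)
  \<comment> \<open>Normalization by the time step costs one power of \<open>t\<close>.\<close>
  then have "(\<lambda>t. 1 / t * (\<Sum>\<sigma>\<in>S. \<Sum>\<sigma>'\<in>S. ?chi t \<sigma> \<sigma>')) \<in> O[at_right 0](\<lambda>t. 1 / t * t ^ Suc m)"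
    by (intro landau_o.big.mult landau_o.big_refl)
  also have "(\<lambda>t::real. 1 / t * t ^ Suc m) \<in> O[at_right 0](\<lambda>t. t ^ m)"
    by (intro bigoI[of _ 1] eventually_mono[OF ev]) auto
  finally have "(\<lambda>t. 1 / t * (\<Sum>\<sigma>\<in>S. \<Sum>\<sigma>'\<in>S. ?chi t \<sigma> \<sigma>')) \<in> O[at_right 0](\<lambda>t. t ^ m)" .
  moreover have "(\<lambda>t. rel_entropy_rate S t (Q t) (P t))
      \<in> O[at_right 0](\<lambda>t. 1 / t * (\<Sum>\<sigma>\<in>S. \<Sum>\<sigma>'\<in>S. ?chi t \<sigma> \<sigma>'))"
  proof (intro bigoI[of _ 1] eventually_mono[OF ev])
    fix t :: real assume t: "0 < t \<and> t \<le> 1"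
    then have "\<bar>rel_entropy_rate S t (Q t) (P t)\<bar> \<le> 1 / t * (\<Sum>\<sigma>\<in>S. \<Sum>\<sigma>'\<in>S. ?chi t \<sigma> \<sigma>')"
      using st pos by (intro rel_entropy_rate_bound fin) auto
    then show "norm (rel_entropy_rate S t (Q t) (P t))
        \<le> 1 * norm (1 / t * (\<Sum>\<sigma>\<in>S. \<Sum>\<sigma>'\<in>S. ?chi t \<sigma> \<sigma>'))"
      unfolding mult_1 real_norm_def by (rule order_trans[OF _ abs_ge_self])
  qed
  ultimately show ?thesis by (rule landau_o.big_trans[rotated])
qed

section \<open>Spin-flip generators\<close>

text \<open>For two configurations on a finite \<open>\<Lambda>\<close>, the least number of single
  flips leading from one to the other.\<close>

definition hamming :: "'a set \<Rightarrow> 'a config \<Rightarrow> 'a config \<Rightarrow> nat" where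
  "hamming \<Lambda> \<sigma> \<tau> = card {x \<in> \<Lambda>. \<sigma> x \<noteq> \<tau> x}"

locale spin_flip =
  fixes \<Lambda> :: "'a set" and q :: "'a config \<Rightarrow> 'a config \<Rightarrow> real"
  assumes finite_sites: "finite \<Lambda>" and rates: "single_flip_rates \<Lambda> q"
begin

abbreviation "S \<equiv> configs \<Lambda>"

lemma finite_configs: "finite S"
  unfolding configs_def using finite_sites by (intro finite_PiE) auto

lemma configs_val: "\<sigma> \<in> S \<Longrightarrow> x \<in> \<Lambda> \<Longrightarrow> \<sigma> x = 0 \<or> \<sigma> x = 1"
  unfolding configs_def by (auto dest: PiE_mem)

lemma flip_configs: "\<sigma> \<in> S \<Longrightarrow> x \<in> \<Lambda> \<Longrightarrow> flip x \<sigma> \<in> S"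
  unfolding configs_def flip_def by (auto simp: PiE_iff extensional_def)

lemma rate_pos:
  assumes "\<sigma> \<in> S" "x \<in> \<Lambda>"
  shows "0 < q \<sigma> (flip x \<sigma>)"
proof -
  \<comment> \<open>\<open>single_flip_rates\<close> speaks only of distinct configurations.
    Subtraction on naturals is truncated, and it does exchange the values because they are 0 or
    1.\<close>
  have "flip x \<sigma> x \<noteq> \<sigma> x" using configs_val[OF assms] by (auto simp: flip_def)
  then have "\<sigma> \<noteq> flip x \<sigma>" by metis
  then show ?thesis
    using rates assms flip_configs[OF assms] unfolding single_flip_rates_def by metis
qed

text \<open>Closure of \<open>S\<close> under flips at sites of \<open>A\<close> makes the generator
  a matrix on \<open>S\<close>. Leaving \<open>A\<close> general covers the full generator and both
  parts of the splitting.\<close>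

lemma kernel_op_generator:
  assumes "A \<subseteq> \<Lambda>"
  shows "kernel_op S (generator q A)"
  unfolding kernel_op_def
proof (intro allI ballI)
  fix f \<sigma> assume s: "\<sigma> \<in> S"
  have "(\<Sum>\<tau>\<in>S. f \<tau> * generator q A (delta \<tau>) \<sigma>)
      = (\<Sum>x\<in>A. \<Sum>\<tau>\<in>S. f \<tau> * (q \<sigma> (flip x \<sigma>) * (delta \<tau> (flip x \<sigma>) - delta \<tau> \<sigma>)))"
    unfolding generator_def sum_distrib_left by (rule sum.swap)
  also have "\<dots> = (\<Sum>x\<in>A. q \<sigma> (flip x \<sigma>) *
      ((\<Sum>\<tau>\<in>S. f \<tau> * delta \<tau> (flip x \<sigma>)) - (\<Sum>\<tau>\<in>S. f \<tau> * delta \<tau> \<sigma>)))"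
    by (simp add: sum_distrib_left sum_subtractf[symmetric] algebra_simps)
  also have "\<dots> = generator q A f \<sigma>"
    unfolding generator_def using assms flip_configs[OF s] s
    by (intro sum.cong refl) (auto simp: sum_mult_delta finite_configs)
  finally show "generator q A f \<sigma> = (\<Sum>\<tau>\<in>S. f \<tau> * generator q A (delta \<tau>) \<sigma>)" by simp
qed

text \<open>A crude bound on the exit rate of every configuration under flips in any part of
  \<open>\<Lambda>\<close>, so one shift serves all generators.\<close>

definition rate_bound :: real where
  "rate_bound = (\<Sum>\<sigma>\<in>S. \<Sum>x\<in>\<Lambda>. q \<sigma> (flip x \<sigma>))"

text \<open>The two sides differ by \<open>f \<sigma>\<close> times the excess of
  \<open>rate_bound\<close> over the exit rate of \<open>\<sigma>\<close>.\<close>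

lemma shifted_generator_ge:
  fixes f :: "'a config \<Rightarrow> real"
  assumes A: "A \<subseteq> \<Lambda>" and s: "\<sigma> \<in> S" and f: "\<And>\<tau>. \<tau> \<in> S \<Longrightarrow> 0 \<le> f \<tau>"
  shows "(\<Sum>x\<in>A. q \<sigma> (flip x \<sigma>) * f (flip x \<sigma>)) \<le> shifted rate_bound (generator q A) f \<sigma>"
proof -
  have "(\<Sum>x\<in>A. q \<sigma> (flip x \<sigma>)) \<le> (\<Sum>x\<in>\<Lambda>. q \<sigma> (flip x \<sigma>))"
    using A finite_sites rate_pos[OF s] by (intro sum_mono2) (auto intro: less_imp_le)
  also have "\<dots> \<le> rate_bound"
    unfolding rate_bound_def using s finite_configs rate_pos
    by (intro member_le_sum[where f = "\<lambda>\<sigma>. \<Sum>x\<in>\<Lambda>. q \<sigma> (flip x \<sigma>)"] sum_nonneg)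
      (auto intro: less_imp_le)
  finally have "(\<Sum>x\<in>A. q \<sigma> (flip x \<sigma>)) * f \<sigma> \<le> rate_bound * f \<sigma>"
    using f[OF s] by (rule mult_right_mono)
  then show ?thesis
    unfolding shifted_def generator_def
    by (simp add: right_diff_distrib sum_subtractf sum_distrib_right)
qed

lemma positive_shifted_generator:
  assumes A: "A \<subseteq> \<Lambda>"
  shows "positive_op S (shifted rate_bound (generator q A))"
  unfolding positive_op_def
proof (intro allI impI ballI)
  fix \<sigma> and f :: "'a config \<Rightarrow> real" assume f: "\<forall>\<tau>\<in>S. 0 \<le> f \<tau>" and s: "\<sigma> \<in> S"
  have "0 \<le> (\<Sum>x\<in>A. q \<sigma> (flip x \<sigma>) * f (flip x \<sigma>))"
    using A f flip_configs[OF s] rate_pos[OF s]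
    by (intro sum_nonneg mult_nonneg_nonneg) (blast intro: less_imp_le)+
  also have "\<dots> \<le> shifted rate_bound (generator q A) f \<sigma>"
    using f by (intro shifted_generator_ge A s) auto
  finally show "0 \<le> shifted rate_bound (generator q A) f \<sigma>" .
qed

lemma markov_generator: "A \<subseteq> \<Lambda> \<Longrightarrow> markov_generator S (generator q A)"
  unfolding markov_generator_def
  using kernel_op_generator positive_shifted_generator by (auto simp: generator_def)

section \<open>Hamming distance and leading orders in \<open>t\<close>\<close>

lemma hamming_flip:
  assumes "x \<in> \<Lambda>"
  shows "hamming \<Lambda> \<sigma> \<tau> \<le> Suc (hamming \<Lambda> (flip x \<sigma>) \<tau>)"
proof -
  have "card {y \<in> \<Lambda>. \<sigma> y \<noteq> \<tau> y} \<le> card (insert x {y \<in> \<Lambda>. flip x \<sigma> y \<noteq> \<tau> y})"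
    using finite_sites by (intro card_mono) (auto simp: flip_def)
  also have "\<dots> \<le> Suc (card {y \<in> \<Lambda>. flip x \<sigma> y \<noteq> \<tau> y})"
    by (rule card_insert_le_m1) auto
  finally show ?thesis unfolding hamming_def .
qed

text \<open>Each application reaches at most one flip further, so \<open>k\<close> of them raise the
  reach of \<open>f\<close> from \<open>j\<close> to \<open>j + k\<close>. A general
  \<open>j\<close> allows powers of different generators to be chained.\<close>

lemma funpow_generator_eq_0:
  fixes f :: "'a config \<Rightarrow> real"
  assumes A: "A \<subseteq> \<Lambda>" and f: "\<And>\<tau>. \<tau> \<in> S \<Longrightarrow> j < hamming \<Lambda> \<tau> \<sigma>' \<Longrightarrow> f \<tau> = 0"
  shows "\<sigma> \<in> S \<Longrightarrow> j + k < hamming \<Lambda> \<sigma> \<sigma>' \<Longrightarrow> (generator q A ^^ k) f \<sigma> = 0"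
proof (induction k arbitrary: \<sigma>)
  case 0
  then show ?case using f by simp
next
  case (Suc k)
  have "(generator q A ^^ k) f (flip x \<sigma>) = 0" if "x \<in> A" for x
    using that A Suc.prems hamming_flip[of x \<sigma> \<sigma>'] by (intro Suc.IH flip_configs) auto
  \<comment> \<open>The generator also contains the value at the unflipped configuration, which lies
    even further beyond the reach.\<close>
  moreover have "(generator q A ^^ k) f \<sigma> = 0"
    using Suc.prems by (intro Suc.IH) auto
  ultimately show ?case by (simp add: generator_def[of q A "(generator q A ^^ k) f"])
qed

lemma delta_eq_0: "0 < hamming \<Lambda> \<tau> \<sigma>' \<Longrightarrow> delta \<sigma>' \<tau> = 0"
  unfolding hamming_def delta_def by auto

text \<open>Flipping a site of disagreement lowers the distance by one. Its gain term is positive,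
  and the other gain terms are nonnegative, so nothing can cancel it.\<close>

lemma funpow_shifted_delta_pos:
  assumes s': "\<sigma>' \<in> S"
  shows "\<sigma> \<in> S \<Longrightarrow> hamming \<Lambda> \<sigma> \<sigma>' = n \<Longrightarrow>
    0 < (shifted rate_bound (generator q \<Lambda>) ^^ n) (delta \<sigma>') \<sigma>"
proof (induction n arbitrary: \<sigma>)
  case 0
  \<comment> \<open>Off \<open>\<Lambda>\<close> both configurations are \<open>undefined\<close>,
    so distance 0 means equality as functions.\<close>
  then have "\<sigma> x = \<sigma>' x" for x
  proof (cases "x \<in> \<Lambda>")
    case True
    then show ?thesis using 0 finite_sites by (auto simp: hamming_def)
  next
    case False
    then show ?thesis using 0 s' by (auto simp: configs_def PiE_iff extensional_def)
  qed
  then have "\<sigma> = \<sigma>'" by blast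
  then show ?case by (simp add: delta_def)
next
  case (Suc n)
  let ?Y = "shifted rate_bound (generator q \<Lambda>)"
  let ?g = "(?Y ^^ n) (delta \<sigma>')"
  have "{x \<in> \<Lambda>. \<sigma> x \<noteq> \<sigma>' x} \<noteq> {}"
    using Suc.prems(2) unfolding hamming_def by (metis card.empty nat.distinct(1))
  then obtain x where x: "x \<in> \<Lambda>" "\<sigma> x \<noteq> \<sigma>' x" by auto
  \<comment> \<open>With only two spin values, flipping a site of disagreement restores agreement
    there.\<close>
  have "flip x \<sigma> x = \<sigma>' x"
    using configs_val[OF Suc.prems(1) x(1)] configs_val[OF s' x(1)] x(2) by (auto simp: flip_def)
  then have "{y \<in> \<Lambda>. flip x \<sigma> y \<noteq> \<sigma>' y} = {y \<in> \<Lambda>. \<sigma> y \<noteq> \<sigma>' y} - {x}"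
    by (auto simp: flip_def)
  then have "hamming \<Lambda> (flip x \<sigma>) \<sigma>' = n"
    using x Suc.prems(2) finite_sites by (simp add: hamming_def)
  then have gpos: "0 < ?g (flip x \<sigma>)" using Suc.IH flip_configs[OF Suc.prems(1) x(1)] by blast
  have g: "0 \<le> ?g \<tau>" if "\<tau> \<in> S" for \<tau>
    by (rule positive_op_funpow[OF positive_shifted_generator]) (use that in \<open>auto simp: delta_def\<close>)
  have "0 < q \<sigma> (flip x \<sigma>) * ?g (flip x \<sigma>)"
    using rate_pos[OF Suc.prems(1) x(1)] gpos by simp
  also have "\<dots> \<le> (\<Sum>x\<in>\<Lambda>. q \<sigma> (flip x \<sigma>) * ?g (flip x \<sigma>))"
    using x finite_sites g flip_configs[OF Suc.prems(1)] rate_pos[OF Suc.prems(1)]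
    by (intro member_le_sum[where f = "\<lambda>x. q \<sigma> (flip x \<sigma>) * ?g (flip x \<sigma>)"] mult_nonneg_nonneg)
      (auto intro: less_imp_le)
  also have "\<dots> \<le> ?Y ?g \<sigma>" by (intro shifted_generator_ge Suc.prems g) auto
  finally show ?case by simp
qed

lemma exact_kernel_lower_bound:
  assumes "\<sigma> \<in> S" "\<sigma>' \<in> S"
  shows "\<exists>c>0. \<forall>t. 0 < t \<longrightarrow> t \<le> 1 \<longrightarrow>
    c * t ^ hamming \<Lambda> \<sigma> \<sigma>' \<le> exact_kernel (generator q \<Lambda>) t \<sigma> \<sigma>'"
proof -
  let ?n = "hamming \<Lambda> \<sigma> \<sigma>'"
  let ?y = "(shifted rate_bound (generator q \<Lambda>) ^^ ?n) (delta \<sigma>') \<sigma>"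
  have y: "0 < ?y" using assms by (intro funpow_shifted_delta_pos) auto
  have r: "0 \<le> rate_bound"
    unfolding rate_bound_def using rate_pos by (intro sum_nonneg) (auto intro: less_imp_le)
  have "exp (- rate_bound) / fact ?n * ?y * t ^ ?n \<le> exact_kernel (generator q \<Lambda>) t \<sigma> \<sigma>'"
    if t: "0 < t" "t \<le> 1" for t
  proof -
    \<comment> \<open>For \<open>t \<le> 1\<close> the exponential prefactor is at least its value
      at 1, which makes the constant independent of \<open>t\<close>.\<close>
    have "exp (- rate_bound) * (t ^ ?n / fact ?n * ?y)
        \<le> exp (- rate_bound * t) * (t ^ ?n / fact ?n * ?y)"
      using y t r by (intro mult_right_mono) (auto simp: mult_left_le)
    also have "\<dots> \<le> op_exp t (generator q \<Lambda>) (delta \<sigma>') \<sigma>"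
      using t assms
      by (intro op_exp_lower_bound[OF finite_configs kernel_op_generator positive_shifted_generator])
        (auto simp: delta_def)
    finally show ?thesis unfolding exact_kernel_def by (simp add: ac_simps)
  qed
  moreover have "0 < exp (- rate_bound) / fact ?n * ?y" using y by simp
  ultimately show ?thesis by blast
qed

text \<open>Here \<open>c\<close> is the coefficient sequence of a kernel's column with target
  \<open>\<sigma>'\<close>: order \<open>n\<close> cannot reach the target when more than
  \<open>n\<close> flips are needed.\<close>

definition flip_limited :: "'a config \<Rightarrow> (nat \<Rightarrow> 'a config \<Rightarrow> real) \<Rightarrow> bool" where
  "flip_limited \<sigma>' c \<longleftrightarrow> (\<forall>n. \<forall>\<sigma>\<in>S. n < hamming \<Lambda> \<sigma> \<sigma>' \<longrightarrow> c n \<sigma> = 0)"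

lemma flip_limited_funpow:
  assumes "A \<subseteq> \<Lambda>"
  shows "flip_limited \<sigma>' (\<lambda>n \<sigma>. a ^ n / fact n * (generator q A ^^ n) (delta \<sigma>') \<sigma>)"
  unfolding flip_limited_def
  using funpow_generator_eq_0[OF assms, of 0 \<sigma>' "delta \<sigma>'"] delta_eq_0 by auto

text \<open>In each Cauchy term the inner coefficient accounts for \<open>n - k\<close> flips and
  the outer powers for \<open>k\<close>, together at most \<open>n\<close>.\<close>

lemma flip_limited_comp:
  assumes "A \<subseteq> \<Lambda>" "flip_limited \<sigma>' c"
  shows "flip_limited \<sigma>' (\<lambda>n \<sigma>. \<Sum>k\<le>n. a ^ k / fact k * (generator q A ^^ k) (c (n - k)) \<sigma>)"
  unfolding flip_limited_def
proof (intro allI ballI impI sum.neutral)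
  fix n \<sigma> k assume *: "\<sigma> \<in> S" "n < hamming \<Lambda> \<sigma> \<sigma>'" "k \<in> {..n}"
  have "(generator q A ^^ k) (c (n - k)) \<sigma> = 0"
    using * assms(2) by (intro funpow_generator_eq_0[OF assms(1)]) (auto simp: flip_limited_def)
  then show "a ^ k / fact k * (generator q A ^^ k) (c (n - k)) \<sigma> = 0" by simp
qed

text \<open>Reduces a splitting to its low-order coefficients. Agreement up to order
  \<open>m\<close> comes from \<open>agree\<close>; at higher orders below the Hamming distance both
  coefficients vanish. This gives the exponent \<open>max d (Suc m)\<close> of the error.\<close>

lemma splitting_rel_entropy_bigo:
  assumes Q: "\<And>\<sigma>'. \<sigma>' \<in> S \<Longrightarrow> power_expansion S (\<lambda>t \<sigma>. Q t \<sigma> \<sigma>') (c \<sigma>')"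
    and lim: "\<And>\<sigma>'. \<sigma>' \<in> S \<Longrightarrow> flip_limited \<sigma>' (c \<sigma>')"
    and st: "\<And>t. 0 < t \<Longrightarrow> stochastic S (Q t)"
    and agree: "\<And>\<sigma> \<sigma>' n. \<sigma> \<in> S \<Longrightarrow> \<sigma>' \<in> S \<Longrightarrow> n \<le> m \<Longrightarrow>
      c \<sigma>' n \<sigma> = (generator q \<Lambda> ^^ n) (delta \<sigma>') \<sigma> / fact n"
  shows "(\<lambda>t. rel_entropy_rate S t (Q t) (exact_kernel (generator q \<Lambda>) t))
    \<in> O[at_right 0](\<lambda>t. t ^ m)"
proof (rule rel_entropy_rate_bigo[where d = "hamming \<Lambda>", OF finite_configs])
  let ?L = "generator q \<Lambda>"
  show "stochastic S (Q t) \<and> stochastic S (exact_kernel ?L t)" if "0 < t" "t \<le> 1" for t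
    using st[OF that(1)] that stochastic_op_exp[OF finite_configs markov_generator[OF order_refl]
        stochastic_delta[OF finite_configs], of t]
    by (simp add: exact_kernel_def[abs_def])
  show "\<exists>c>0. \<forall>t. 0 < t \<longrightarrow> t \<le> 1 \<longrightarrow> c * t ^ hamming \<Lambda> \<sigma> \<sigma>' \<le> exact_kernel ?L t \<sigma> \<sigma>'"
    if "\<sigma> \<in> S" "\<sigma>' \<in> S" for \<sigma> \<sigma>'
    using that by (rule exact_kernel_lower_bound)
  fix \<sigma> \<sigma>' assume s: "\<sigma> \<in> S" "\<sigma>' \<in> S"
  let ?p = "\<lambda>n \<sigma>. 1 ^ n / fact n * (?L ^^ n) (delta \<sigma>') \<sigma>"
  have P: "power_expansion S (\<lambda>t \<sigma>. exact_kernel ?L t \<sigma> \<sigma>') ?p"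
    using power_expansion_op_exp[OF finite_configs kernel_op_generator[OF order_refl], of 1]
    by (simp add: exact_kernel_def)
  have "c \<sigma>' n \<sigma> = ?p n \<sigma>" if n: "n < max (hamming \<Lambda> \<sigma> \<sigma>') (Suc m)" for n
  proof (cases "n \<le> m")
    case True
    then show ?thesis using agree s by simp
  next
    case False
    then have "n < hamming \<Lambda> \<sigma> \<sigma>'" using n by simp
    then show ?thesis
      using lim[OF s(2)] flip_limited_funpow[OF order_refl, of \<sigma>' 1] s(1)
      unfolding flip_limited_def by simp
  qed
  then show "\<exists>C. \<forall>t. 0 < t \<longrightarrow> t \<le> 1 \<longrightarrow>
      \<bar>Q t \<sigma> \<sigma>' - exact_kernel ?L t \<sigma> \<sigma>'\<bar> \<le> C * t ^ max (hamming \<Lambda> \<sigma> \<sigma>') (Suc m)"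
    using power_expansion_diff_bound[OF Q[OF s(2)] P s(1)] by (metis less_imp_le)
qed

section \<open>Low-order coefficients of the Lie and Strang kernels\<close>

lemma generator_add:
  "generator q C (\<lambda>\<rho>. f \<rho> + g \<rho>) \<sigma> = generator q C f \<sigma> + generator q C g \<sigma>"
  unfolding generator_def sum.distrib[symmetric] by (rule sum.cong[OF refl]) (simp add: algebra_simps)

lemma generator_cmult: "generator q C (\<lambda>\<rho>. a * f \<rho>) \<sigma> = a * generator q C f \<sigma>"
  unfolding generator_def sum_distrib_left by (rule sum.cong[OF refl]) (simp add: algebra_simps)

lemma generator_divide: "generator q C (\<lambda>\<rho>. f \<rho> / a) \<sigma> = generator q C f \<sigma> / a"
  using generator_cmult[of C "1 / a" f \<sigma>] by simp

context
  fixes A B :: "'a set"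
  assumes AB: "A \<union> B = \<Lambda>" "A \<inter> B = {}"
begin

lemma A_B_subset: "A \<subseteq> \<Lambda>" "B \<subseteq> \<Lambda>"
  using AB by auto

text \<open>Disjointness keeps any site from being counted twice.\<close>

lemma generator_split: "generator q \<Lambda> f \<sigma> = generator q A f \<sigma> + generator q B f \<sigma>"
  unfolding generator_def AB(1)[symmetric]
  using A_B_subset finite_sites AB by (intro sum.union_disjoint) (auto intro: finite_subset)

text \<open>The orders 0 and 1 are the identity and the sum of the two parts. At order 2 the Lie
  coefficient exceeds the exact one by half the commutator, so \<open>m = 1\<close>.\<close>

lemma lie_rel_entropy_bigo:
  "(\<lambda>t. rel_entropy_rate S t (lie_kernel (generator q A) (generator q B) t)
      (exact_kernel (generator q \<Lambda>) t)) \<in> O[at_right 0](\<lambda>t. t ^ 1)"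
proof (rule splitting_rel_entropy_bigo)
  let ?A = "generator q A" and ?B = "generator q B"
  let ?b = "\<lambda>\<sigma>' n \<sigma>. 1 ^ n / fact n * (?B ^^ n) (delta \<sigma>') \<sigma>"
  let ?c = "\<lambda>\<sigma>' n \<sigma>. \<Sum>k\<le>n. 1 ^ k / fact k * (?A ^^ k) (?b \<sigma>' (n - k)) \<sigma>"
  note K = kernel_op_generator[OF A_B_subset(1)] kernel_op_generator[OF A_B_subset(2)]
  note M = markov_generator[OF A_B_subset(1)] markov_generator[OF A_B_subset(2)]
  show "power_expansion S (\<lambda>t \<sigma>. lie_kernel ?A ?B t \<sigma> \<sigma>') (?c \<sigma>')" for \<sigma>'
    using power_expansion_op_exp_comp[OF finite_configs K(1)
        power_expansion_op_exp[OF finite_configs K(2), of 1 "delta \<sigma>'"], of 1]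
    by (simp add: lie_kernel_def)
  show "flip_limited \<sigma>' (?c \<sigma>')" for \<sigma>'
    by (intro flip_limited_comp flip_limited_funpow A_B_subset)
  show "stochastic S (lie_kernel ?A ?B t)" if "0 < t" for t
    using stochastic_op_exp[OF finite_configs M(1) stochastic_op_exp[OF finite_configs M(2)
          stochastic_delta[OF finite_configs], of t], of t] that
    by (simp add: lie_kernel_def[abs_def])
  show "?c \<sigma>' n \<sigma> = (generator q \<Lambda> ^^ n) (delta \<sigma>') \<sigma> / fact n" if "n \<le> 1" for \<sigma> \<sigma>' n
  proof -
    consider "n = 0" | "n = 1" using \<open>n \<le> 1\<close> by force
    then show ?thesis by cases (simp_all add: generator_split)
  qed
qed

text \<open>The symmetric arrangement of half steps removes the commutator at order 2, so
  \<open>m = 2\<close>.\<close>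

lemma strang_rel_entropy_bigo:
  "(\<lambda>t. rel_entropy_rate S t (strang_kernel (generator q A) (generator q B) t)
      (exact_kernel (generator q \<Lambda>) t)) \<in> O[at_right 0](\<lambda>t. t ^ 2)"
proof (rule splitting_rel_entropy_bigo)
  let ?A = "generator q A" and ?B = "generator q B"
  let ?a = "\<lambda>\<sigma>' n \<sigma>. (1 / 2) ^ n / fact n * (?A ^^ n) (delta \<sigma>') \<sigma>"
  let ?b = "\<lambda>\<sigma>' n \<sigma>. \<Sum>k\<le>n. 1 ^ k / fact k * (?B ^^ k) (?a \<sigma>' (n - k)) \<sigma>"
  let ?c = "\<lambda>\<sigma>' n \<sigma>. \<Sum>k\<le>n. (1 / 2) ^ k / fact k * (?A ^^ k) (?b \<sigma>' (n - k)) \<sigma>"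
  note K = kernel_op_generator[OF A_B_subset(1)] kernel_op_generator[OF A_B_subset(2)]
  note M = markov_generator[OF A_B_subset(1)] markov_generator[OF A_B_subset(2)]
  show "power_expansion S (\<lambda>t \<sigma>. strang_kernel ?A ?B t \<sigma> \<sigma>') (?c \<sigma>')" for \<sigma>'
    using power_expansion_op_exp_comp[OF finite_configs K(1)
        power_expansion_op_exp_comp[OF finite_configs K(2)
          power_expansion_op_exp[OF finite_configs K(1), of "1 / 2" "delta \<sigma>'"], of 1], of "1 / 2"]
    by (simp add: strang_kernel_def)
  show "flip_limited \<sigma>' (?c \<sigma>')" for \<sigma>'
    by (intro flip_limited_comp flip_limited_funpow A_B_subset)
  show "stochastic S (strang_kernel ?A ?B t)" if "0 < t" for t
    using stochastic_op_exp[OF finite_configs M(1) stochastic_op_exp[OF finite_configs M(2)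
          stochastic_op_exp[OF finite_configs M(1) stochastic_delta[OF finite_configs],
            of "t / 2"], of t], of "t / 2"] that
    by (simp add: strang_kernel_def[abs_def])
  show "?c \<sigma>' n \<sigma> = (generator q \<Lambda> ^^ n) (delta \<sigma>') \<sigma> / fact n" if "n \<le> 2" for \<sigma> \<sigma>' n
  proof -
    consider "n = 0" | "n = 1" | "n = 2" using \<open>n \<le> 2\<close> by force
    then show ?thesis
    proof cases
      \<comment> \<open>With A and B for the two parts, A squared collects 1/8 + 1/4 + 1/8 = 1/2,
        and AB, BA and B squared each have coefficient 1/2. This is half the square of A +
        B.\<close>
      case 3
      then show ?thesis
        unfolding numeral_2_eq_2
        by (simp add: generator_split[abs_def] generator_add generator_cmult generator_divide
            add_divide_distrib)
    qed (simp_all add: generator_split)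
  qed
qed

end

end

theorem theorem5p2:
  fixes \<Lambda> :: "(int ^ 'd) set"
    and q :: "(int ^ 'd) config \<Rightarrow> (int ^ 'd) config \<Rightarrow> real"
    and \<Omega> :: "int ^ 'd \<Rightarrow> (int ^ 'd) set"
    and \<G>1 \<G>2 :: "(int ^ 'd) set set"
    and L L1 L2 :: "(int ^ 'd) config operator"
  assumes "finite \<Lambda>"
    and "single_flip_rates \<Lambda> q"
    and "localized_rates \<Lambda> q \<Omega>"
    and "lattice_decomposition \<Lambda> \<Omega> \<G>1 \<G>2"
    and "L = generator q \<Lambda>"
    and "L1 = generator q (\<Union>\<G>1)"
    and "L2 = generator q (\<Union>\<G>2)"
  shows
    "((\<exists>\<sigma>\<in>configs \<Lambda>. \<exists>x\<in>\<Lambda>. \<exists>y\<in>\<Lambda>. x \<noteq> y \<and>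
         lie_commutator L1 L2 \<sigma> (flip y (flip x \<sigma>)) \<noteq> 0) \<longrightarrow>
       (\<lambda>t. rel_entropy_rate (configs \<Lambda>) t (lie_kernel L1 L2 t) (exact_kernel L t))
         \<in> O[at_right 0](\<lambda>t. t)) \<and>
     ((\<exists>\<sigma>\<in>configs \<Lambda>. \<exists>x\<in>\<Lambda>. \<exists>y\<in>\<Lambda>. \<exists>z\<in>\<Lambda>. x \<noteq> y \<and> x \<noteq> z \<and> y \<noteq> z \<and>
         strang_commutator L1 L2 \<sigma> (flip z (flip y (flip x \<sigma>))) \<noteq> 0) \<longrightarrow>
       (\<lambda>t. rel_entropy_rate (configs \<Lambda>) t (strang_kernel L1 L2 t) (exact_kernel L t))
         \<in> O[at_right 0](\<lambda>t. t ^ 2))"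
proof -
  interpret spin_flip \<Lambda> q using assms by unfold_locales
  have part: "partition_on \<Lambda> (\<G>1 \<union> \<G>2)" "\<G>1 \<inter> \<G>2 = {}"
    using assms(4) unfolding lattice_decomposition_def by auto
  have "\<Union>\<G>1 \<union> \<Union>\<G>2 = \<Lambda>" using part(1) unfolding partition_on_def by auto
  \<comment> \<open>Distinct blocks of the partition are disjoint and the groups share no block, so
    their unions are disjoint.\<close>
  moreover have "\<Union>\<G>1 \<inter> \<Union>\<G>2 = {}"
    using Int_Union_pairwise_disjoint[of \<G>1 \<G>2] part by (simp add: partition_on_def)
  ultimately show ?thesis
    using lie_rel_entropy_bigo strang_rel_entropy_bigo assms(5-7) by simp
qed

end
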